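(* Let $\Gamma$ be a commutative group and $T$ a commutative ternary $\Gamma$-semiring. Let $X=\mathrm{Spec}_\Gamma(T)$ be finite and suppose $X$ decomposes as a disjoint union of clopen subsets $X=X_1\sqcup\cdots\sqcup X_r$. Then the specialization graph $G_X$ is the disjoint union of the induced subgraphs $G_{X_i}$, and the Laplacian $L_X$ is permutation-similar to the block diagonal matrix $$\begin{pmatrix} L_{X_1}&0&\cdots&0\\ 0&L_{X_2}&\cdots&0\\ \vdots&\vdots&\ddots&\vdots\\ 0&0&\cdots&L_{X_r}\end{pmatrix}.$$
   Context: A commutative semiring is a tuple $(T,+,\cdot,0,1)$ with $(T,+,0)$ and $(T,\cdot,1)$ commutative monoids, multiplication distributing over addition, and $0\cdot x=x\cdot 0=0$. A commutative ternary $\Gamma$-semiring $(T,u)$ is a commutative semiring $T$ with a group homomorphism $u:\Gamma\to T^\times$, $\gamma\mapsto u_\gamma$, together with the operations $\{a\,b\,c\}_\gamma:=a b c u_\gamma$. A $\Gamma$-ideal of $T$ is a subset $I$ which is a submonoid of $(T,+,0)$ and satisfies $\{a\,b\,c\}_\gamma\in I$ for all $a\in I$, $b,c\in T$, $\gamma\in\Gamma$. A proper $\Gamma$-ideal $P$ is prime if $\{a\,b\,c\}_\gamma\in P$ implies $a\in P$ or $b\in P$ or $c\in P$, for all $a,b,c\in T$, $\gamma\in\Gamma$. $\mathrm{Spec}_\Gamma(T)$ is the set of prime $\Gamma$-ideals with the topology whose closed sets are $V(I)=\{P\mid I\subseteq P\}$ for $\Gamma$-ideals $I$. For finite $X=\mathrm{Spec}_\Gamma(T)$,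 the specialization order is $P\le Q$ iff $P\subseteq Q$ (equivalently $Q\in\overline{\{P\}}$). The specialization graph $G_X$ is the undirected graph with vertex set $X$ and an edge between distinct $P\ne Q$ iff $P\subseteq Q$ or $Q\subseteq P$. The canonical Laplacian is $L_X:=D_X-A_X$, with $A_X$ the adjacency matrix and $D_X$ the diagonal degree matrix of $G_X$. For a subset $X_i\subseteq X$, $G_{X_i}$ is the induced subgraph on $X_i$ and $L_{X_i}$ is its Laplacian (degree matrix minus adjacency matrix). *)

theory Defs
  imports
    "HOL-Algebra.Ring"
    "HOL-Analysis.Abstract_Topology"
    "HOL-Combinatorics.Permutations"
    "Jordan_Normal_Form.Matrix"
    "Graph_Theory.Digraph_Component"
begin

section \<open>Commutative ternary \<open>\<Gamma>\<close>-semirings\<close>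

locale ternary_gamma_semiring =
  Ring.semiring T + comm_monoid T + Gamma: comm_group \<Gamma>
  for \<Gamma> :: "('g, 'm) monoid_scheme" and T :: "('a, 'n) ring_scheme" (structure) +
  fixes u :: "'g \<Rightarrow> 'a"
  assumes u_hom: "u \<in> hom \<Gamma> (units_of T)"

definition tprod :: "('a, 'n) ring_scheme \<Rightarrow> ('g \<Rightarrow> 'a) \<Rightarrow> 'g \<Rightarrow> 'a \<Rightarrow> 'a \<Rightarrow> 'a \<Rightarrow> 'a" where
  "tprod T u \<gamma> a b c = a \<otimes>\<^bsub>T\<^esub> b \<otimes>\<^bsub>T\<^esub> c \<otimes>\<^bsub>T\<^esub> u \<gamma>"

definition gamma_ideal ::
  "('g, 'm) monoid_scheme \<Rightarrow> ('a, 'n) ring_scheme \<Rightarrow> ('g \<Rightarrow> 'a) \<Rightarrow> 'a set \<Rightarrow> bool" where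
  "gamma_ideal \<Gamma> T u I \<longleftrightarrow>
     submonoid I (add_monoid T) \<and>
     (\<forall>a\<in>I. \<forall>b\<in>carrier T. \<forall>c\<in>carrier T. \<forall>\<gamma>\<in>carrier \<Gamma>. tprod T u \<gamma> a b c \<in> I)"

definition prime_gamma_ideal ::
  "('g, 'm) monoid_scheme \<Rightarrow> ('a, 'n) ring_scheme \<Rightarrow> ('g \<Rightarrow> 'a) \<Rightarrow> 'a set \<Rightarrow> bool" where
  "prime_gamma_ideal \<Gamma> T u P \<longleftrightarrow>
     gamma_ideal \<Gamma> T u P \<and> P \<noteq> carrier T \<and>
     (\<forall>a\<in>carrier T. \<forall>b\<in>carrier T. \<forall>c\<in>carrier T. \<forall>\<gamma>\<in>carrier \<Gamma>.
        tprod T u \<gamma> a b c \<in> P \<longrightarrow> a \<in> P \<or> b \<in> P \<or> c \<in> P)"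

definition Spec ::
  "('g, 'm) monoid_scheme \<Rightarrow> ('a, 'n) ring_scheme \<Rightarrow> ('g \<Rightarrow> 'a) \<Rightarrow> 'a set set" where
  "Spec \<Gamma> T u = {P. prime_gamma_ideal \<Gamma> T u P}"

definition V ::
  "('g, 'm) monoid_scheme \<Rightarrow> ('a, 'n) ring_scheme \<Rightarrow> ('g \<Rightarrow> 'a) \<Rightarrow> 'a set \<Rightarrow> 'a set set" where
  "V \<Gamma> T u I = {P \<in> Spec \<Gamma> T u. I \<subseteq> P}"

text \<open>
  The constant \<open>topology\<close> is only meaningful on predicates satisfying \<open>istopology\<close>; that this one
  does, and that its closed sets are exactly the sets \<open>V I\<close>, is proved in
  \<open>closedin_spec_topology\<close> below.
\<close>

definition spec_topology ::
  "('g, 'm) monoid_scheme \<Rightarrow> ('a, 'n) ring_scheme \<Rightarrow> ('g \<Rightarrow> 'a) \<Rightarrow> 'a set topology" where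
  "spec_topology \<Gamma> T u =
     topology (\<lambda>U. \<exists>I. gamma_ideal \<Gamma> T u I \<and> U = Spec \<Gamma> T u - V \<Gamma> T u I)"

context ternary_gamma_semiring
begin

lemma u_closed: "\<gamma> \<in> carrier \<Gamma> \<Longrightarrow> u \<gamma> \<in> carrier T"
  using u_hom by (auto simp: hom_def units_of_def)

lemma u_one: "u \<one>\<^bsub>\<Gamma>\<^esub> = \<one>"
proof -
  have "group (units_of T)" by (rule units_group)
  then have "u \<one>\<^bsub>\<Gamma>\<^esub> = \<one>\<^bsub>units_of T\<^esub>"
    using u_hom Gamma.is_group by (metis hom_one)
  then show ?thesis by (simp add: units_of_one)
qed

lemma tprod_closed:
  "\<lbrakk>a \<in> carrier T; b \<in> carrier T; c \<in> carrier T; \<gamma> \<in> carrier \<Gamma>\<rbrakk> \<Longrightarrow> tprod T u \<gamma> a b c \<in> carrier T"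
  by (simp add: tprod_def u_closed)

lemma gamma_ideal_subset: "gamma_ideal \<Gamma> T u I \<Longrightarrow> I \<subseteq> carrier T"
  by (auto simp: gamma_ideal_def submonoid_def)

lemma gamma_ideal_carrier: "gamma_ideal \<Gamma> T u (carrier T)"
  by (auto simp: gamma_ideal_def submonoid_def tprod_closed)

lemma gamma_ideal_Inter:
  assumes "\<J> \<noteq> {}" "\<And>J. J \<in> \<J> \<Longrightarrow> gamma_ideal \<Gamma> T u J"
  shows "gamma_ideal \<Gamma> T u (\<Inter>\<J>)"
proof -
  obtain J where J: "J \<in> \<J>" using assms(1) by blast
  show ?thesis
    unfolding gamma_ideal_def
  proof (intro conjI ballI submonoid.intro)
    show "\<Inter>\<J> \<subseteq> carrier (add_monoid T)"
      using J gamma_ideal_subset[OF assms(2)] by auto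
  next
    fix x y assume xy: "x \<in> \<Inter>\<J>" "y \<in> \<Inter>\<J>"
    show "x \<otimes>\<^bsub>add_monoid T\<^esub> y \<in> \<Inter>\<J>"
    proof
      fix K assume "K \<in> \<J>"
      with xy assms(2) show "x \<otimes>\<^bsub>add_monoid T\<^esub> y \<in> K"
        unfolding gamma_ideal_def by (meson InterD submonoid.m_closed)
    qed
  next
    show "\<one>\<^bsub>add_monoid T\<^esub> \<in> \<Inter>\<J>"
      using assms(2) unfolding gamma_ideal_def by (meson InterI submonoid.one_closed)
  next
    fix a b c \<gamma>
    assume "a \<in> \<Inter>\<J>" "b \<in> carrier T" "c \<in> carrier T" "\<gamma> \<in> carrier \<Gamma>"
    then show "tprod T u \<gamma> a b c \<in> \<Inter>\<J>"
      using assms(2) unfolding gamma_ideal_def by blast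
  qed
qed

lemma one_notin_prime:
  assumes "prime_gamma_ideal \<Gamma> T u P"
  shows "\<one> \<notin> P"
proof
  assume one: "\<one> \<in> P"
  have P: "gamma_ideal \<Gamma> T u P" using assms by (simp add: prime_gamma_ideal_def)
  have "c \<in> P" if c: "c \<in> carrier T" for c
  proof -
    have "tprod T u \<one>\<^bsub>\<Gamma>\<^esub> \<one> \<one> c \<in> P"
      using P one c by (simp add: gamma_ideal_def)
    then show ?thesis using c by (simp add: tprod_def u_one)
  qed
  then have "P = carrier T" using gamma_ideal_subset[OF P] by auto
  then show False using assms by (simp add: prime_gamma_ideal_def)
qed

lemma V_Int:
  assumes I: "gamma_ideal \<Gamma> T u I" and J: "gamma_ideal \<Gamma> T u J"
  shows "V \<Gamma> T u (I \<inter> J) = V \<Gamma> T u I \<union> V \<Gamma> T u J"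
proof -
  have "I \<subseteq> P \<or> J \<subseteq> P" if P: "prime_gamma_ideal \<Gamma> T u P" and IJ: "I \<inter> J \<subseteq> P" for P
  proof (rule ccontr)
    assume "\<not> ?thesis"
    then obtain a b where a: "a \<in> I" "a \<notin> P" and b: "b \<in> J" "b \<notin> P" by auto
    have ab: "a \<in> carrier T" "b \<in> carrier T"
      using a b gamma_ideal_subset[OF I] gamma_ideal_subset[OF J] by auto
    have "tprod T u \<one>\<^bsub>\<Gamma>\<^esub> a b \<one> \<in> I" using I a ab by (simp add: gamma_ideal_def)
    moreover have "tprod T u \<one>\<^bsub>\<Gamma>\<^esub> b a \<one> \<in> J" using J b ab by (simp add: gamma_ideal_def)
    moreover have "tprod T u \<one>\<^bsub>\<Gamma>\<^esub> b a \<one> = tprod T u \<one>\<^bsub>\<Gamma>\<^esub> a b \<one>"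
      using ab by (simp add: tprod_def m_comm)
    ultimately have "tprod T u \<one>\<^bsub>\<Gamma>\<^esub> a b \<one> \<in> P" using IJ by auto
    then have "a \<in> P \<or> b \<in> P \<or> \<one> \<in> P"
      using P ab one_closed Gamma.one_closed unfolding prime_gamma_ideal_def by blast
    then show False using a b one_notin_prime[OF P] by auto
  qed
  then show ?thesis by (auto simp: V_def Spec_def)
qed

lemma istopology_spec:
  "istopology (\<lambda>U. \<exists>I. gamma_ideal \<Gamma> T u I \<and> U = Spec \<Gamma> T u - V \<Gamma> T u I)"
  (is "istopology ?L")
  unfolding istopology_def
proof (intro conjI allI impI)
  fix A B assume "?L A" "?L B"
  then obtain I J where I: "gamma_ideal \<Gamma> T u I" "A = Spec \<Gamma> T u - V \<Gamma> T u I"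
    and J: "gamma_ideal \<Gamma> T u J" "B = Spec \<Gamma> T u - V \<Gamma> T u J" by blast
  have "gamma_ideal \<Gamma> T u (I \<inter> J)"
    using gamma_ideal_Inter[of "{I, J}"] I J by auto
  moreover have "A \<inter> B = Spec \<Gamma> T u - V \<Gamma> T u (I \<inter> J)"
    using V_Int[OF I(1) J(1)] I J by auto
  ultimately show "?L (A \<inter> B)" by blast
next
  fix \<K> assume K: "\<forall>K\<in>\<K>. ?L K"
  define \<J> where "\<J> = {J. gamma_ideal \<Gamma> T u J \<and>
    (\<forall>I. gamma_ideal \<Gamma> T u I \<longrightarrow> Spec \<Gamma> T u - V \<Gamma> T u I \<in> \<K> \<longrightarrow> I \<subseteq> J)}"
  have "carrier T \<in> \<J>"
    by (auto simp: \<J>_def gamma_ideal_carrier dest: gamma_ideal_subset)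
  then have ideal: "gamma_ideal \<Gamma> T u (\<Inter>\<J>)"
    by (intro gamma_ideal_Inter) (auto simp: \<J>_def)
  have "P \<in> \<Union>\<K> \<longleftrightarrow> P \<in> Spec \<Gamma> T u - V \<Gamma> T u (\<Inter>\<J>)" for P
  proof
    assume "P \<in> \<Union>\<K>"
    then obtain K where K1: "K \<in> \<K>" "P \<in> K" ..
    then obtain I where "gamma_ideal \<Gamma> T u I" "K = Spec \<Gamma> T u - V \<Gamma> T u I"
      using K by metis
    with K1 have "gamma_ideal \<Gamma> T u I" "Spec \<Gamma> T u - V \<Gamma> T u I \<in> \<K>"
      "P \<in> Spec \<Gamma> T u - V \<Gamma> T u I" by simp_all
    moreover from this have "I \<subseteq> \<Inter>\<J>" by (auto simp: \<J>_def)
    ultimately show "P \<in> Spec \<Gamma> T u - V \<Gamma> T u (\<Inter>\<J>)" unfolding V_def by blast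
  next
    assume P: "P \<in> Spec \<Gamma> T u - V \<Gamma> T u (\<Inter>\<J>)"
    then have "P \<notin> \<J>" by (auto simp: V_def)
    moreover have "gamma_ideal \<Gamma> T u P"
      using P by (simp add: Spec_def prime_gamma_ideal_def)
    ultimately obtain I where "Spec \<Gamma> T u - V \<Gamma> T u I \<in> \<K>" "\<not> I \<subseteq> P"
      by (auto simp: \<J>_def)
    moreover from this have "P \<in> Spec \<Gamma> T u - V \<Gamma> T u I" using P by (simp add: V_def)
    ultimately show "P \<in> \<Union>\<K>" by (meson UnionI)
  qed
  then have "\<Union>\<K> = Spec \<Gamma> T u - V \<Gamma> T u (\<Inter>\<J>)" by blast
  with ideal show "?L (\<Union>\<K>)" by blast
qed

lemma openin_spec_topology:
  "openin (spec_topology \<Gamma> T u) U \<longleftrightarrow>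
     (\<exists>I. gamma_ideal \<Gamma> T u I \<and> U = Spec \<Gamma> T u - V \<Gamma> T u I)"
  unfolding spec_topology_def by (subst topology_inverse'[OF istopology_spec]) (rule refl)

lemma topspace_spec_topology: "topspace (spec_topology \<Gamma> T u) = Spec \<Gamma> T u"
proof -
  have "V \<Gamma> T u (carrier T) = {}"
    unfolding V_def Spec_def prime_gamma_ideal_def using gamma_ideal_subset by blast
  then have "openin (spec_topology \<Gamma> T u) (Spec \<Gamma> T u)"
    using gamma_ideal_carrier by (auto simp: openin_spec_topology)
  moreover have "topspace (spec_topology \<Gamma> T u) \<subseteq> Spec \<Gamma> T u"
    by (auto simp: topspace_def openin_spec_topology)
  ultimately show ?thesis using openin_subset by blast
qed

lemma closedin_spec_topology:
  "closedin (spec_topology \<Gamma> T u) C \<longleftrightarrow> (\<exists>I. gamma_ideal \<Gamma> T u I \<and> C = V \<Gamma> T u I)"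
proof -
  have "V \<Gamma> T u I \<subseteq> Spec \<Gamma> T u" for I by (auto simp: V_def)
  then show ?thesis
    unfolding closedin_def topspace_spec_topology openin_spec_topology by blast
qed

end

section \<open>Specialization graph\<close>

text \<open>
  As in the graph library, an undirected graph is a symmetric digraph: an edge between \<open>P\<close> and
  \<open>Q\<close> is the pair of arcs \<open>(P, Q)\<close>, \<open>(Q, P)\<close>.
\<close>

definition spec_graph ::
  "('g, 'm) monoid_scheme \<Rightarrow> ('a, 'n) ring_scheme \<Rightarrow> ('g \<Rightarrow> 'a) \<Rightarrow>
     ('a set, 'a set \<times> 'a set) pre_digraph" where
  "spec_graph \<Gamma> T u =
     \<lparr> verts = Spec \<Gamma> T u,
       arcs = {(P, Q). P \<in> Spec \<Gamma> T u \<and> Q \<in> Spec \<Gamma> T u \<and> P \<noteq> Q \<and> (P \<subseteq> Q \<or> Q \<subseteq> P)},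
       tail = fst, head = snd \<rparr>"

lemma graph_spec_graph:
  assumes "finite (Spec \<Gamma> T u)"
  shows "graph (spec_graph \<Gamma> T u)"
proof -
  have "finite (arcs (spec_graph \<Gamma> T u))"
    by (rule finite_subset[of _ "Spec \<Gamma> T u \<times> Spec \<Gamma> T u"])
       (use assms in \<open>auto simp: spec_graph_def\<close>)
  then show ?thesis
    using assms
    by unfold_locales
       (auto simp: spec_graph_def arc_to_ends_def symmetric_def arcs_ends_def sym_def image_iff)
qed

definition is_disjoint_union ::
  "('v, 'e) pre_digraph \<Rightarrow> 'i set \<Rightarrow> ('i \<Rightarrow> ('v, 'e) pre_digraph) \<Rightarrow> bool" where
  "is_disjoint_union G I H \<longleftrightarrow>
     (\<forall>i\<in>I. subgraph (H i) G) \<and>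
     disjoint_family_on (\<lambda>i. verts (H i)) I \<and>
     verts G = (\<Union>i\<in>I. verts (H i)) \<and>
     arcs G = (\<Union>i\<in>I. arcs (H i))"

section \<open>Laplacian\<close>

text \<open>
  Matrices indexed by a finite vertex set \<open>S\<close> are written down with respect to an enumeration of
  \<open>S\<close>, that is, a list in which every element of \<open>S\<close> occurs exactly once.
\<close>

definition enumerates :: "'v list \<Rightarrow> 'v set \<Rightarrow> bool" where
  "enumerates vs S \<longleftrightarrow> distinct vs \<and> set vs = S"

definition adjacency_matrix :: "('v, 'e) pre_digraph \<Rightarrow> 'v list \<Rightarrow> real mat" where
  "adjacency_matrix G vs =
     mat (length vs) (length vs) (\<lambda>(i, j). if (vs ! i, vs ! j) \<in> arcs_ends G then 1 else 0)"

text \<open>In a symmetric digraph without parallel arcs, the out-degree is the undirected degree.\<close>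

definition degree_matrix :: "('v, 'e) pre_digraph \<Rightarrow> 'v list \<Rightarrow> real mat" where
  "degree_matrix G vs =
     mat (length vs) (length vs) (\<lambda>(i, j). if i = j then of_nat (out_degree G (vs ! i)) else 0)"

definition laplacian :: "('v, 'e) pre_digraph \<Rightarrow> 'v list \<Rightarrow> real mat" where
  "laplacian G vs = degree_matrix G vs - adjacency_matrix G vs"

definition permutation_matrix :: "nat \<Rightarrow> (nat \<Rightarrow> nat) \<Rightarrow> real mat" where
  "permutation_matrix n p = mat n n (\<lambda>(i, j). if p i = j then 1 else 0)"

definition permutation_similar :: "real mat \<Rightarrow> real mat \<Rightarrow> bool" where
  "permutation_similar A B \<longleftrightarrow>
     (\<exists>n p. A \<in> carrier_mat n n \<and> B \<in> carrier_mat n n \<and> p permutes {..<n} \<and>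
        A = permutation_matrix n p * B * transpose_mat (permutation_matrix n p))"

end

theory Submission
  imports Defs
begin

text \<open>
  Every closed set \<open>V I\<close> of the spectrum contains, along with a prime, all larger primes, so closed
  sets are up-sets for inclusion and open sets are down-sets. A clopen set is therefore closed under
  passing to comparable primes: it is a union of connected components of the specialization graph,
  with no edge crossing its boundary (\<open>spec_graph_arc_in_clopen\<close>). The rest is
  a statement about an arbitrary digraph with a vertex partition that no arc crosses.

  Since no arc crosses, every arc lies in exactly one induced subgraph, which is the disjoint union
  statement (\<open>disjoint_union_of_induced_subgraphs\<close>). It also means that a vertex keeps its degree
  when passing to its part, so the Laplacian of a part is the corresponding block of the whole
  Laplacian (\<open>laplacian_induce_subgraph\<close>), while the entries outside these blocks vanish
  (\<open>laplacian_concat\<close>). Hence, when the vertices are listed part by part, the Laplacian \<^emph>\<open>equals\<close>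
  the block diagonal matrix; any other enumeration differs by a reordering of the vertices, which
  conjugates the Laplacian by a permutation matrix (\<open>laplacian_permutation_similar\<close>).
\<close>

section \<open>Clopen sets and specialization\<close>

context ternary_gamma_semiring
begin

lemma closedin_spec_superset:
  assumes "closedin (spec_topology \<Gamma> T u) C" "P \<in> C" "P \<subseteq> Q" "Q \<in> Spec \<Gamma> T u"
  shows "Q \<in> C"
  using assms by (auto simp: closedin_spec_topology V_def)

lemma openin_spec_subset:
  assumes "openin (spec_topology \<Gamma> T u) U" "Q \<in> U" "P \<subseteq> Q" "P \<in> Spec \<Gamma> T u"
  shows "P \<in> U"
  using assms by (auto simp: openin_spec_topology V_def)

lemma spec_graph_arc_in_clopen:
  assumes clopen: "openin (spec_topology \<Gamma> T u) C" "closedin (spec_topology \<Gamma> T u) C"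
    and arc: "e \<in> arcs (spec_graph \<Gamma> T u)"
  shows "tail (spec_graph \<Gamma> T u) e \<in> C \<longleftrightarrow> head (spec_graph \<Gamma> T u) e \<in> C"
proof -
  obtain P Q where e: "e = (P, Q)"
    and PQ: "P \<in> Spec \<Gamma> T u" "Q \<in> Spec \<Gamma> T u" "P \<subseteq> Q \<or> Q \<subseteq> P"
    using arc by (cases e) (auto simp: spec_graph_def)
  from PQ have "P \<in> C \<longleftrightarrow> Q \<in> C"
    using closedin_spec_superset[OF clopen(2)] openin_spec_subset[OF clopen(1)] by metis
  then show ?thesis by (simp add: e spec_graph_def)
qed

end

section \<open>Vertex partitions that no arc crosses\<close>

lemma disjoint_union_of_induced_subgraphs:
  assumes "wf_digraph G"
    and "disjoint_family_on Y I"
    and verts: "verts G = (\<Union>i\<in>I. Y i)"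
    and arc: "\<And>i e. i \<in> I \<Longrightarrow> e \<in> arcs G \<Longrightarrow> tail G e \<in> Y i \<longleftrightarrow> head G e \<in> Y i"
  shows "is_disjoint_union G I (\<lambda>i. G \<restriction> Y i)"
proof -
  interpret wf_digraph G by fact
  have "subgraph (G \<restriction> Y i) G" if "i \<in> I" for i
    using that verts by (intro induced_imp_subgraph induced_induce) auto
  moreover have "arcs G = (\<Union>i\<in>I. arcs (G \<restriction> Y i))"
  proof
    show "arcs G \<subseteq> (\<Union>i\<in>I. arcs (G \<restriction> Y i))"
    proof
      fix e assume e: "e \<in> arcs G"
      then obtain i where "i \<in> I" "tail G e \<in> Y i"
        using tail_in_verts verts by auto
      with e arc show "e \<in> (\<Union>i\<in>I. arcs (G \<restriction> Y i))" by auto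
    qed
  qed auto
  ultimately show ?thesis
    using assms by (simp add: is_disjoint_union_def)
qed

section \<open>Laplacians and enumerations of the vertices\<close>

lemma laplacian_carrier: "laplacian G vs \<in> carrier_mat (length vs) (length vs)"
  by (simp add: laplacian_def degree_matrix_def adjacency_matrix_def minus_carrier_mat)

lemma dim_laplacian [simp]:
  "dim_row (laplacian G vs) = length vs" "dim_col (laplacian G vs) = length vs"
  using laplacian_carrier[of G vs] by auto

lemma index_laplacian:
  assumes "i < length vs" "j < length vs"
  shows "laplacian G vs $$ (i, j) =
    (if i = j then of_nat (out_degree G (vs ! i)) else 0) -
    (if (vs ! i, vs ! j) \<in> arcs_ends G then 1 else 0)"
  using assms by (simp add: laplacian_def degree_matrix_def adjacency_matrix_def)

text \<open>
  The degrees agree because no arc leaves the part; without this, the diagonal of the Laplacian of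
  an induced subgraph could be smaller than that of the ambient graph.
\<close>

lemma laplacian_induce_subgraph:
  assumes "set vs \<subseteq> C"
    and closed: "\<And>e. e \<in> arcs G \<Longrightarrow> tail G e \<in> C \<Longrightarrow> head G e \<in> C"
  shows "laplacian (G \<restriction> C) vs = laplacian G vs"
proof (rule eq_matI)
  have deg: "out_degree (G \<restriction> C) v = out_degree G v" if "v \<in> C" for v
  proof -
    have "out_arcs (G \<restriction> C) v = out_arcs G v"
      using that closed by (auto simp: out_arcs_def)
    then show ?thesis by (simp add: out_degree_def)
  qed
  have ends: "(v, w) \<in> arcs_ends (G \<restriction> C) \<longleftrightarrow> (v, w) \<in> arcs_ends G" if "v \<in> C" "w \<in> C" for v w
    using that by (auto simp: arcs_ends_def arc_to_ends_def image_iff)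
  fix i j assume "i < dim_row (laplacian G vs)" "j < dim_col (laplacian G vs)"
  moreover from this have "vs ! i \<in> C" "vs ! j \<in> C"
    using \<open>set vs \<subseteq> C\<close> by auto
  ultimately show "laplacian (G \<restriction> C) vs $$ (i, j) = laplacian G vs $$ (i, j)"
    by (simp add: index_laplacian deg ends)
qed simp_all

lemma laplacian_append:
  assumes "\<And>v w. v \<in> set vs \<Longrightarrow> w \<in> set ws \<Longrightarrow> (v, w) \<notin> arcs_ends G \<and> (w, v) \<notin> arcs_ends G"
  shows "laplacian G (vs @ ws) =
    four_block_mat (laplacian G vs) (0\<^sub>m (length vs) (length ws))
      (0\<^sub>m (length ws) (length vs)) (laplacian G ws)"
  by (rule eq_matI) (use assms in \<open>auto simp: index_laplacian nth_append\<close>)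

lemma laplacian_concat:
  assumes "sorted_wrt
    (\<lambda>vs ws. \<forall>v\<in>set vs. \<forall>w\<in>set ws. (v, w) \<notin> arcs_ends G \<and> (w, v) \<notin> arcs_ends G) vss"
  shows "laplacian G (concat vss) = diag_block_mat (map (laplacian G) vss)"
  using assms
proof (induction vss)
  case Nil
  show ?case by (rule eq_matI) simp_all
next
  case (Cons vs vss)
  then have IH: "laplacian G (concat vss) = diag_block_mat (map (laplacian G) vss)" by simp
  have "laplacian G (concat (vs # vss)) =
    four_block_mat (laplacian G vs) (0\<^sub>m (length vs) (length (concat vss)))
      (0\<^sub>m (length (concat vss)) (length vs)) (laplacian G (concat vss))"
    unfolding concat.simps by (rule laplacian_append) (use Cons.prems in auto)
  also have "\<dots> = diag_block_mat (map (laplacian G) (vs # vss))"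
    by (simp add: Let_def flip: IH)
  finally show ?case .
qed

lemma index_permutation_matrix_conj:
  assumes B: "B \<in> carrier_mat n n" and p: "p permutes {..<n}" and ij: "i < n" "j < n"
  shows "(permutation_matrix n p * B * transpose_mat (permutation_matrix n p)) $$ (i, j) =
    B $$ (p i, p j)"
proof -
  have p_less: "p k < n" if "k < n" for k
    using permutes_in_image[OF p, of k] that by simp
  have left: "(permutation_matrix n p * B) $$ (i, k) = B $$ (p i, k)" if "k < n" for k
  proof -
    have "(permutation_matrix n p * B) $$ (i, k) =
      (\<Sum>l\<in>{0..<n}. if p i = l then B $$ (l, k) else 0)"
      using B ij that
      by (simp add: permutation_matrix_def scalar_prod_def if_distrib[of "\<lambda>c. c * _"]
          cong: sum.cong_simp if_cong)
    then show ?thesis using p_less[OF ij(1)] by simp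
  qed
  have "(permutation_matrix n p * B * transpose_mat (permutation_matrix n p)) $$ (i, j) =
    (\<Sum>k\<in>{0..<n}. (permutation_matrix n p * B) $$ (i, k) * (if p j = k then 1 else 0))"
    using B ij by (simp add: permutation_matrix_def scalar_prod_def cong: sum.cong_simp)
  also have "\<dots> = (\<Sum>k\<in>{0..<n}. if p j = k then B $$ (p i, k) else 0)"
    by (intro sum.cong) (auto simp: left)
  also have "\<dots> = B $$ (p i, p j)" using p_less[OF ij(2)] by simp
  finally show ?thesis .
qed

lemma laplacian_permutation_similar:
  assumes "mset vs = mset ws"
  shows "permutation_similar (laplacian G vs) (laplacian G ws)"
proof -
  obtain p where p: "p permutes {..<length ws}" and vs: "permute_list p ws = vs"
    using mset_eq_permutation[OF assms] by blast
  define n where "n = length ws"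
  have len: "length vs = n" using assms n_def mset_eq_length by blast
  note pn = p[folded n_def]
  have nth: "vs ! i = ws ! p i" "p i < length ws" if "i < n" for i
    using that permute_list_nth[OF p] vs permutes_in_image[OF p, of i] by (auto simp: n_def)
  have "laplacian G vs =
    permutation_matrix n p * laplacian G ws * transpose_mat (permutation_matrix n p)"
    (is "_ = ?R")
  proof (rule eq_matI)
    show dims: "dim_row (laplacian G vs) = dim_row ?R" "dim_col (laplacian G vs) = dim_col ?R"
      by (simp_all add: permutation_matrix_def len)
    fix i j assume "i < dim_row ?R" "j < dim_col ?R"
    then have ij: "i < n" "j < n" using dims len by simp_all
    have "p i = p j \<longleftrightarrow> i = j" using permutes_inj[OF p] by (auto dest: injD)
    then have "laplacian G vs $$ (i, j) = laplacian G ws $$ (p i, p j)"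
      using ij by (simp add: index_laplacian len nth)
    also have "\<dots> = ?R $$ (i, j)"
      using index_permutation_matrix_conj[OF _ pn ij] laplacian_carrier n_def by metis
    finally show "laplacian G vs $$ (i, j) = ?R $$ (i, j)" .
  qed
  then show ?thesis
    unfolding permutation_similar_def using laplacian_carrier len n_def pn by metis
qed

text \<open>
  Listing the vertices part by part makes the Laplacian equal to the block diagonal matrix; this
  listing and \<open>xs\<close> are permutations of each other.
\<close>

lemma laplacian_block_diagonal:
  assumes idx: "distinct idx"
    and disj: "disjoint_family_on Y (set idx)"
    and xs: "enumerates xs (\<Union>i\<in>set idx. Y i)"
    and ys: "\<And>i. i \<in> set idx \<Longrightarrow> enumerates (ys i) (Y i)"
    and arc: "\<And>i e. i \<in> set idx \<Longrightarrow> e \<in> arcs G \<Longrightarrow> tail G e \<in> Y i \<longleftrightarrow> head G e \<in> Y i"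
  shows "permutation_similar (laplacian G xs)
    (diag_block_mat (map (\<lambda>i. laplacian (G \<restriction> Y i) (ys i)) idx))"
proof -
  have no_arc: "(v, w) \<notin> arcs_ends G \<and> (w, v) \<notin> arcs_ends G"
    if "i \<in> set idx" "j \<in> set idx" "i \<noteq> j" "v \<in> Y i" "w \<in> Y j" for i j v w
  proof -
    have "w \<notin> Y i" using disj that by (auto simp: disjoint_family_on_def)
    then show ?thesis
      using arc[OF that(1)] that(4) by (auto simp: arcs_ends_def arc_to_ends_def)
  qed
  have "sorted_wrt (\<noteq>) idx"
    using idx by (simp add: distinct_conv_nth sorted_wrt_iff_nth_less)
  then have "sorted_wrt
    (\<lambda>vs ws. \<forall>v\<in>set vs. \<forall>w\<in>set ws. (v, w) \<notin> arcs_ends G \<and> (w, v) \<notin> arcs_ends G) (map ys idx)"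
    unfolding sorted_wrt_map
    by (rule sorted_wrt_mono_rel[rotated]) (use no_arc ys in \<open>auto simp: enumerates_def\<close>)
  then have "laplacian G (concat (map ys idx)) = diag_block_mat (map (laplacian G) (map ys idx))"
    by (rule laplacian_concat)
  also have "map (laplacian G) (map ys idx) = map (\<lambda>i. laplacian (G \<restriction> Y i) (ys i)) idx"
    using ys arc by (auto simp: enumerates_def intro!: laplacian_induce_subgraph[symmetric])
  finally have blocks: "laplacian G (concat (map ys idx)) =
    diag_block_mat (map (\<lambda>i. laplacian (G \<restriction> Y i) (ys i)) idx)" .
  \<comment> \<open>Empty parts may share the empty list, so \<open>map ys idx\<close> need not be distinct and
    distinctness of the concatenation is obtained by induction on \<open>idx\<close>.\<close>
  have "distinct (concat (map ys idx))"
    using idx disj ys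
  proof (induction idx)
    case (Cons i idx)
    have "Y i \<inter> Y j = {}" if "j \<in> set idx" for j
      using Cons.prems(1,2) that by (auto simp: disjoint_family_on_def)
    moreover have "disjoint_family_on Y (set idx)"
      using Cons.prems(2) by (rule disjoint_family_on_mono[rotated]) auto
    ultimately show ?case
      using Cons.IH Cons.prems(1,3) by (fastforce simp: enumerates_def)
  qed simp
  moreover have "set (concat (map ys idx)) = set xs"
    using xs ys by (auto simp: enumerates_def)
  ultimately have "mset xs = mset (concat (map ys idx))"
    using xs set_eq_iff_mset_eq_distinct by (metis enumerates_def)
  then show ?thesis
    unfolding blocks[symmetric] by (rule laplacian_permutation_similar)
qed

section \<open>Clopen decompositions of the spectrum\<close>

theorem theorem8:
  fixes \<Gamma> :: "('g, 'm) monoid_scheme"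
    and T :: "('a, 'n) ring_scheme"
    and u :: "'g \<Rightarrow> 'a"
    and r :: nat
    and Y :: "nat \<Rightarrow> 'a set set"
  assumes "ternary_gamma_semiring \<Gamma> T u"
    and "finite (Spec \<Gamma> T u)"
    and "\<And>i. i \<in> {1..r} \<Longrightarrow> openin (spec_topology \<Gamma> T u) (Y i)"
    and "\<And>i. i \<in> {1..r} \<Longrightarrow> closedin (spec_topology \<Gamma> T u) (Y i)"
    and "disjoint_family_on Y {1..r}"
    and "Spec \<Gamma> T u = (\<Union>i\<in>{1..r}. Y i)"
  shows "is_disjoint_union (spec_graph \<Gamma> T u) {1..r} (\<lambda>i. spec_graph \<Gamma> T u \<restriction> Y i) \<and>
    (\<forall>xs ys. enumerates xs (Spec \<Gamma> T u) \<and> (\<forall>i\<in>{1..r}. enumerates (ys i) (Y i)) \<longrightarrow>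
      permutation_similar
        (laplacian (spec_graph \<Gamma> T u) xs)
        (diag_block_mat
          (map (\<lambda>i. laplacian (spec_graph \<Gamma> T u \<restriction> Y i) (ys i)) [1..<Suc r])))"
proof -
  interpret ternary_gamma_semiring \<Gamma> T u by fact
  let ?G = "spec_graph \<Gamma> T u"
  interpret graph ?G by (rule graph_spec_graph) fact
  have arc: "tail ?G e \<in> Y i \<longleftrightarrow> head ?G e \<in> Y i" if "i \<in> {1..r}" "e \<in> arcs ?G" for i e
    using spec_graph_arc_in_clopen assms(3,4) that by blast
  have range: "set [1..<Suc r] = {1..r}" by auto
  have "verts ?G = (\<Union>i\<in>{1..r}. Y i)"
    using assms(6) by (simp add: spec_graph_def)
  with wf_digraph_axioms assms(5) have "is_disjoint_union ?G {1..r} (\<lambda>i. ?G \<restriction> Y i)"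
    using arc by (rule disjoint_union_of_induced_subgraphs)
  moreover have "permutation_similar (laplacian ?G xs)
      (diag_block_mat (map (\<lambda>i. laplacian (?G \<restriction> Y i) (ys i)) [1..<Suc r]))"
    if "enumerates xs (Spec \<Gamma> T u)" "\<forall>i\<in>{1..r}. enumerates (ys i) (Y i)" for xs ys
    using distinct_upt
  proof (rule laplacian_block_diagonal; (unfold range)?)
    show "enumerates xs (\<Union>i\<in>{1..r}. Y i)"
      using that(1) unfolding assms(6) .
  qed (use that(2) assms(5) arc in blast)+
  ultimately show ?thesis by blast
qed

end
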